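(* There is an absolute constant $C>0$ such that the following holds. Let $A$ be a real $n\times n$ matrix, let $2<q\le n$, and let $Q$ be a random subset of $\{1,\dots,n\}$ in which each element is included independently with probability $q/n$. Then $$\mathbb E\,\|A|_Q\|_2\ \le\ C\Bigl(\sqrt{\tfrac qn}\,\|A\|_2+\sqrt{\log q}\;\|A\|_{(n/q)}\Bigr).$$
   Context: $\|\cdot\|_2$ is the spectral norm. $A|_Q$ denotes the matrix obtained from $A$ by keeping the columns indexed by $Q$ (equivalently, replacing all columns with index outside $Q$ by zero columns; this does not change the spectral norm). For real $k\ge1$, $\|A\|_{(k)}=\frac1k\sum_{j=1}^{\lfloor k\rfloor}a_j$, where $a_1\ge a_2\ge\dots\ge a_n$ are the Euclidean lengths of the columns of $A$ arranged in nonincreasing order (i.e. essentially the average of the $k$ largest column lengths). *)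

theory Defs
  imports "HOL-Analysis.Analysis"
begin

text \<open>Real n x n matrices are represented as functions nat => nat => real,
  only the entries with indices < n being relevant (rows i < n, columns j < n).
  Indices run over {0..<n} instead of {1..n}.\<close>

definition mat_vec_norm :: "nat \<Rightarrow> (nat \<Rightarrow> nat \<Rightarrow> real) \<Rightarrow> (nat \<Rightarrow> real) \<Rightarrow> real" where
  "mat_vec_norm n A x = sqrt (\<Sum>i<n. (\<Sum>j<n. A i j * x j)\<^sup>2)"

definition spec_norm :: "nat \<Rightarrow> (nat \<Rightarrow> nat \<Rightarrow> real) \<Rightarrow> real" where
  "spec_norm n A = Sup {mat_vec_norm n A x | x. (\<Sum>j<n. (x j)\<^sup>2) \<le> 1}"

definition restrict_cols :: "(nat \<Rightarrow> nat \<Rightarrow> real) \<Rightarrow> nat set \<Rightarrow> (nat \<Rightarrow> nat \<Rightarrow> real)" where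
  "restrict_cols A Q = (\<lambda>i j. if j \<in> Q then A i j else 0)"

definition col_norm :: "nat \<Rightarrow> (nat \<Rightarrow> nat \<Rightarrow> real) \<Rightarrow> nat \<Rightarrow> real" where
  "col_norm n A j = sqrt (\<Sum>i<n. (A i j)\<^sup>2)"

definition sorted_col_norms :: "nat \<Rightarrow> (nat \<Rightarrow> nat \<Rightarrow> real) \<Rightarrow> real list" where
  "sorted_col_norms n A = rev (sort (map (col_norm n A) [0..<n]))"

definition knorm :: "nat \<Rightarrow> real \<Rightarrow> (nat \<Rightarrow> nat \<Rightarrow> real) \<Rightarrow> real" where
  "knorm n k A = (1 / k) * sum_list (take (nat \<lfloor>k\<rfloor>) (sorted_col_norms n A))"

definition expect_subset :: "nat \<Rightarrow> real \<Rightarrow> (nat set \<Rightarrow> real) \<Rightarrow> real" where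
  "expect_subset n p f = (\<Sum>Q\<in>Pow {..<n}. p ^ card Q * (1 - p) ^ (n - card Q) * f Q)"

end

theory Submission
  imports Defs
begin

text \<open>Columns longer than twice \<open>knorm n (n / q) A\<close> number at most \<open>n / q\<close>, so by the triangle inequality
  they contribute at most \<open>(q / n) (n / q) knorm n (n / q) A\<close> to the expectation. This leaves matrices
  whose columns \<open>x\<^sub>j\<close> all satisfy \<open>\<bar>x\<^sub>j\<bar>\<^sup>2 \<le> b\<close>, and these are treated by moments rather than by the
  noncommutative Khinchine inequality. Let \<open>S = \<Sum>\<^sub>j\<^sub>\<in>\<^sub>Q x\<^sub>j x\<^sub>j\<^sup>T\<close> and \<open>p = q / n\<close>. Independence gives
  \<open>E tr S\<^sup>m\<^sup>+\<^sup>1 = p \<Sum>\<^sub>j E \<langle>x\<^sub>j, (S with j added to Q)\<^sup>m x\<^sub>j\<rangle>\<close>. Since the moments \<open>\<langle>x, T\<^sup>k x\<rangle>\<close> of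
  a positive semidefinite \<open>T\<close> are log-convex in \<open>k\<close>,
  \<open>\<langle>x, (T + x x\<^sup>T)\<^sup>m x\<rangle> \<le> e \<langle>x, T\<^sup>m x\<rangle> + b ((m + 1) b)\<^sup>m\<close>; this turns the identity into a recursion,
  whose solution is \<open>E tr S\<^sup>m \<le> q M\<^sup>m\<close> as long as \<open>M\<close> dominates both \<open>e p \<parallel>A\<parallel>\<^sup>2\<close> and \<open>m b\<close>.
  Taking \<open>m = \<lceil>ln q\<rceil>\<close> makes the factor \<open>q\<close> at most \<open>e\<^sup>m\<close>.\<close>

section \<open>Inner products and powers of the frame operator\<close>

definition ip :: "nat \<Rightarrow> (nat \<Rightarrow> real) \<Rightarrow> (nat \<Rightarrow> real) \<Rightarrow> real" where
  "ip n u v = (\<Sum>i<n. u i * v i)"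

definition unit_vec :: "nat \<Rightarrow> nat \<Rightarrow> real" where
  "unit_vec i = (\<lambda>j. if j = i then 1 else 0)"

text \<open>The matrix sum of \<open>x\<^sub>j x\<^sub>j\<^sup>T\<close> over \<open>Q\<close>, kept
  as a map on vectors so that its powers are iterates. The index of the vector comes first: a matrix
  \<open>A\<close> enters as its transpose \<open>\<lambda>j i. A i j\<close>.\<close>

definition frame_op ::
    "nat \<Rightarrow> (nat \<Rightarrow> nat \<Rightarrow> real) \<Rightarrow> nat set \<Rightarrow> (nat \<Rightarrow> real) \<Rightarrow> nat \<Rightarrow> real" where
  "frame_op n X Q v = (\<lambda>i. \<Sum>j\<in>Q. ip n (X j) v * X j i)"

definition frame_tr :: "nat \<Rightarrow> (nat \<Rightarrow> nat \<Rightarrow> real) \<Rightarrow> nat set \<Rightarrow> nat \<Rightarrow> real" where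
  "frame_tr n X Q m = (\<Sum>i<n. ip n (unit_vec i) ((frame_op n X Q ^^ m) (unit_vec i)))"

lemma ip_commute: "ip n u v = ip n v u"
  by (simp add: ip_def mult.commute)

lemma ip_add_right: "ip n u (\<lambda>i. v i + w i) = ip n u v + ip n u w"
  by (simp add: ip_def sum.distrib algebra_simps)

lemma ip_scale_right: "ip n u (\<lambda>i. c * v i) = c * ip n u v"
  by (simp add: ip_def sum_distrib_left algebra_simps)

lemma ip_sum_right: "ip n u (\<lambda>i. \<Sum>j\<in>Q. c j * v j i) = (\<Sum>j\<in>Q. c j * ip n u (v j))"
  unfolding ip_def sum_distrib_left by (subst sum.swap) (simp add: algebra_simps)

lemma ip_self_nonneg: "0 \<le> ip n u u"
  by (simp add: ip_def sum_nonneg)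

lemma ip_self_eq: "ip n u u = (\<Sum>i<n. (u i)\<^sup>2)"
  by (simp add: ip_def power2_eq_square)

lemma Cauchy_Schwarz_ip: "(ip n u v)\<^sup>2 \<le> ip n u u * ip n v v"
  unfolding ip_self_eq by (simp add: ip_def Cauchy_Schwarz_ineq_sum)

lemma ip_unit_vec: "i < n \<Longrightarrow> ip n (unit_vec i) v = v i"
  by (simp add: ip_def unit_vec_def if_distrib[of "\<lambda>x. x * _"] cong: if_cong)

lemma ip_frame_op: "ip n u (frame_op n X Q v) = (\<Sum>j\<in>Q. ip n (X j) u * ip n (X j) v)"
  unfolding frame_op_def ip_sum_right by (simp add: ip_commute mult.commute)

lemma frame_op_adjoint: "ip n u (frame_op n X Q v) = ip n (frame_op n X Q u) v"
  by (subst (2) ip_commute) (simp add: ip_frame_op mult.commute)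

lemma frame_pow_adjoint:
  "ip n u ((frame_op n X Q ^^ k) v) = ip n ((frame_op n X Q ^^ k) u) v"
  by (induction k arbitrary: u)
     (simp_all add: frame_op_adjoint flip: funpow_swap1)

text \<open>Self-adjointness moves half of the power to each side. For odd \<open>m\<close> one
  factor stays in the middle, and its rank-one terms supply the vectors, padded with zeros outside
  \<open>Q\<close>. This is semidefiniteness in a form to which Cauchy-Schwarz applies.\<close>

lemma frame_pow_sum_squares:
  assumes "Q \<subseteq> {..<n}"
  shows "\<exists>W. \<forall>u v. ip n u ((frame_op n X Q ^^ m) v) = (\<Sum>t<n. ip n (W t) u * ip n (W t) v)"
proof -
  let ?F = "frame_op n X Q"
  have split: "ip n u ((?F ^^ (l + k)) v) = ip n ((?F ^^ l) u) ((?F ^^ k) v)" for u v l k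
    by (simp add: funpow_add frame_pow_adjoint[of n u])
  show ?thesis
  proof (cases "even m")
    case True
    then obtain l where m: "m = l + l" by (metis evenE mult_2)
    have "ip n u ((?F ^^ m) v)
        = (\<Sum>t<n. ip n ((?F ^^ l) (unit_vec t)) u * ip n ((?F ^^ l) (unit_vec t)) v)" for u v
      unfolding m split by (subst ip_def) (simp add: frame_pow_adjoint[symmetric] ip_unit_vec)
    then show ?thesis by (intro exI[of _ "\<lambda>t. (?F ^^ l) (unit_vec t)"]) simp
  next
    case False
    then obtain l where m: "m = l + Suc l" by (metis oddE mult_2 Suc_eq_plus1 add_Suc_right)
    define W where "W t = (if t \<in> Q then (?F ^^ l) (X t) else (\<lambda>_. 0))" for t
    have "ip n u ((?F ^^ m) v) = (\<Sum>t<n. ip n (W t) u * ip n (W t) v)" for u v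
    proof -
      have "ip n u ((?F ^^ m) v)
          = (\<Sum>t\<in>Q. ip n ((?F ^^ l) (X t)) u * ip n ((?F ^^ l) (X t)) v)"
        unfolding m split by (simp add: ip_frame_op frame_pow_adjoint[symmetric])
      also have "\<dots> = (\<Sum>t\<in>Q. ip n (W t) u * ip n (W t) v)"
        by (simp add: W_def)
      also have "\<dots> = (\<Sum>t<n. ip n (W t) u * ip n (W t) v)"
        using assms by (intro sum.mono_neutral_left) (auto simp: W_def ip_def)
      finally show ?thesis .
    qed
    then show ?thesis by (intro exI[of _ W]) simp
  qed
qed

lemma frame_pow_nonneg:
  assumes "Q \<subseteq> {..<n}"
  shows "0 \<le> ip n u ((frame_op n X Q ^^ m) u)"
proof -
  obtain W where "\<And>u v. ip n u ((frame_op n X Q ^^ m) v) = (\<Sum>t<n. ip n (W t) u * ip n (W t) v)"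
    using frame_pow_sum_squares[OF assms, where X=X and m=m] by blast
  then show ?thesis by (simp add: sum_nonneg)
qed

text \<open>Cauchy-Schwarz for the semidefinite form of the \<open>m\<close>-th power, applied to
  \<open>u\<close> and its image under the operator.\<close>

lemma frame_moments_log_convex:
  assumes "Q \<subseteq> {..<n}"
  shows "(ip n u ((frame_op n X Q ^^ Suc m) u))\<^sup>2
      \<le> ip n u ((frame_op n X Q ^^ m) u) * ip n u ((frame_op n X Q ^^ Suc (Suc m)) u)"
proof -
  let ?F = "frame_op n X Q"
  obtain W where W: "\<And>u v. ip n u ((?F ^^ m) v) = (\<Sum>t<n. ip n (W t) u * ip n (W t) v)"
    using frame_pow_sum_squares[OF assms, where X=X and m=m] by blast
  have "(ip n u ((?F ^^ m) (?F u)))\<^sup>2 \<le> ip n u ((?F ^^ m) u) * ip n (?F u) ((?F ^^ m) (?F u))"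
    unfolding W using Cauchy_Schwarz_ineq_sum[of "\<lambda>t. ip n (W t) u" "\<lambda>t. ip n (W t) (?F u)" "{..<n}"]
    by (simp add: power2_eq_square)
  moreover have "ip n (?F u) ((?F ^^ m) (?F u)) = ip n u ((?F ^^ Suc (Suc m)) u)"
    by (metis frame_op_adjoint funpow.simps(2) funpow_swap1 o_apply)
  ultimately show ?thesis
    by (simp add: funpow_swap1)
qed

lemma frame_tr_nonneg: "Q \<subseteq> {..<n} \<Longrightarrow> 0 \<le> frame_tr n X Q m"
  unfolding frame_tr_def by (intro sum_nonneg frame_pow_nonneg)

lemma frame_tr_sum_squares:
  assumes "\<And>u v. ip n u ((frame_op n X Q ^^ m) v) = (\<Sum>t<n. ip n (W t) u * ip n (W t) v)"
  shows "frame_tr n X Q m = (\<Sum>t<n. ip n (W t) (W t))"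
proof -
  have "frame_tr n X Q m = (\<Sum>i<n. \<Sum>t<n. W t i * W t i)"
    unfolding frame_tr_def assms by (simp add: ip_commute[of n _ "unit_vec _"] ip_unit_vec)
  also have "\<dots> = (\<Sum>t<n. ip n (W t) (W t))"
    unfolding ip_def by (rule sum.swap)
  finally show ?thesis .
qed

text \<open>Cauchy-Schwarz on each \<open>W t\<close>; their squared lengths sum to the
  trace.\<close>

lemma frame_pow_le_tr:
  assumes "Q \<subseteq> {..<n}"
  shows "ip n u ((frame_op n X Q ^^ m) u) \<le> ip n u u * frame_tr n X Q m"
proof -
  obtain W where W: "\<And>u v. ip n u ((frame_op n X Q ^^ m) v) = (\<Sum>t<n. ip n (W t) u * ip n (W t) v)"
    using frame_pow_sum_squares[OF assms, where X=X and m=m] by blast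
  have "ip n u ((frame_op n X Q ^^ m) u) \<le> (\<Sum>t<n. ip n (W t) (W t) * ip n u u)"
    unfolding W using Cauchy_Schwarz_ip by (intro sum_mono) (simp add: power2_eq_square)
  also have "\<dots> = ip n u u * frame_tr n X Q m"
    by (simp add: frame_tr_sum_squares[OF W] sum_distrib_left mult.commute)
  finally show ?thesis .
qed

text \<open>Cyclicity of the trace. The result is a sum over the members of \<open>Q\<close>, on
  which independence can act.\<close>

lemma frame_tr_Suc:
  "frame_tr n X Q (Suc m) = (\<Sum>j\<in>Q. ip n (X j) ((frame_op n X Q ^^ m) (X j)))"
proof -
  let ?F = "frame_op n X Q"
  have "frame_tr n X Q (Suc m)
      = (\<Sum>i<n. \<Sum>j\<in>Q. X j i * ip n (X j) ((?F ^^ m) (unit_vec i)))"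
    unfolding frame_tr_def
    by (simp add: ip_frame_op ip_commute[of n _ "unit_vec _"] ip_unit_vec)
  also have "\<dots> = (\<Sum>i<n. \<Sum>j\<in>Q. X j i * ((?F ^^ m) (X j)) i)"
    by (simp add: frame_pow_adjoint[of n "X _"] ip_commute[of n _ "unit_vec _"] ip_unit_vec)
  also have "\<dots> = (\<Sum>j\<in>Q. ip n (X j) ((?F ^^ m) (X j)))"
    unfolding ip_def by (rule sum.swap)
  finally show ?thesis .
qed

text \<open>The hypothesis on \<open>c\<close> is tested on each \<open>W t\<close>, and the squared
  lengths of these vectors sum to the trace.\<close>

lemma frame_bound_tr:
  assumes "Q \<subseteq> {..<n}"
    and "\<And>y. (\<Sum>j<n. (ip n (X j) y)\<^sup>2) \<le> c * ip n y y"
  shows "(\<Sum>j<n. ip n (X j) ((frame_op n X Q ^^ m) (X j))) \<le> c * frame_tr n X Q m"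
proof -
  obtain W where W: "\<And>u v. ip n u ((frame_op n X Q ^^ m) v) = (\<Sum>t<n. ip n (W t) u * ip n (W t) v)"
    using frame_pow_sum_squares[OF assms(1), where X=X and m=m] by blast
  have "(\<Sum>j<n. ip n (X j) ((frame_op n X Q ^^ m) (X j))) = (\<Sum>t<n. \<Sum>j<n. (ip n (X j) (W t))\<^sup>2)"
    unfolding W by (subst sum.swap) (simp add: power2_eq_square ip_commute)
  also have "\<dots> \<le> (\<Sum>t<n. c * ip n (W t) (W t))"
    by (intro sum_mono assms(2))
  also have "\<dots> = c * frame_tr n X Q m"
    by (simp add: frame_tr_sum_squares[OF W] sum_distrib_left)
  finally show ?thesis .
qed

lemma frame_op_insert:
  assumes "finite Q" "j \<notin> Q"
  shows "frame_op n X (insert j Q) v = (\<lambda>i. frame_op n X Q v i + ip n (X j) v * X j i)"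
  using assms by (simp add: frame_op_def fun_eq_iff add.commute)

text \<open>Each product in the expansion of \<open>(S + x x\<^sup>T)\<^sup>m\<close> is split at its first factor \<open>x x\<^sup>T\<close>.\<close>

lemma frame_pow_insert:
  assumes "finite Q" "j \<notin> Q"
  shows "ip n u ((frame_op n X (insert j Q) ^^ m) v) = ip n u ((frame_op n X Q ^^ m) v)
    + (\<Sum>k<m. ip n u ((frame_op n X Q ^^ k) (X j))
              * ip n (X j) ((frame_op n X (insert j Q) ^^ (m - Suc k)) v))"
proof (induction m arbitrary: u)
  case (Suc m)
  let ?F = "frame_op n X Q" and ?G = "frame_op n X (insert j Q)"
  have "ip n u ((?G ^^ Suc m) v) = ip n (?F u) ((?G ^^ m) v) + ip n u (X j) * ip n (X j) ((?G ^^ m) v)"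
    by (simp add: frame_op_insert[OF assms] ip_add_right ip_scale_right frame_op_adjoint)
  then show ?case
    unfolding Suc.IH[of "?F u"] sum.lessThan_Suc_shift by (simp add: frame_op_adjoint del: sum.lessThan_Suc)
qed simp

section \<open>Log-convex sequences and the renewal recursion\<close>

text \<open>After division by \<open>s 0 * a ^ k\<close> the sequence is still log-convex, so once
  it increases it keeps increasing. A value above \<open>u 0 = 1\<close> would then persist up to
  \<open>m\<close>, against \<open>u m \<le> 1\<close>.\<close>

lemma log_convex_le_geometric:
  fixes s :: "nat \<Rightarrow> real"
  assumes nonneg: "\<And>k. 0 \<le> s k" and logc: "\<And>k. (s (Suc k))\<^sup>2 \<le> s k * s (Suc (Suc k))"
    and "0 < s 0" "0 < a" "s m \<le> s 0 * a ^ m" "k \<le> m"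
  shows "s k \<le> s 0 * a ^ k"
proof -
  define u where "u k = s k / (s 0 * a ^ k)" for k
  have u0: "u 0 = 1" and um: "u m \<le> 1" and nn: "\<And>k. 0 \<le> u k"
    using assms by (simp_all add: u_def divide_simps)
  have uc: "(u (Suc k))\<^sup>2 \<le> u k * u (Suc (Suc k))" for k
    using logc[of k] \<open>0 < s 0\<close> \<open>0 < a\<close> 
    by (simp add: u_def power2_eq_square divide_simps mult_ac)
  have step: "u k < u (Suc k) \<Longrightarrow> u (Suc k) < u (Suc (Suc k))" for k
  proof (rule ccontr)
    assume "u k < u (Suc k)" "\<not> u (Suc k) < u (Suc (Suc k))"
    then have "u k * u (Suc (Suc k)) < u (Suc k) * u (Suc k)"
      using nn[of k] by (intro order.strict_trans1[OF mult_left_mono mult_strict_right_mono]) auto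
    then show False using uc[of k] by (simp add: power2_eq_square)
  qed
  have "u k \<le> 1"
  proof (rule ccontr)
    assume "\<not> u k \<le> 1"
    moreover have "u k \<le> u 0" if "\<forall>i<k. u (Suc i) \<le> u i"
      using that by (induction k) (auto intro: order_trans)
    ultimately obtain i where i: "i < k" "u i < u (Suc i)"
      using u0 by fastforce
    have incr: "u (i + l) < u (Suc (i + l))" for l
      by (induction l) (use i step in auto)
    have "u k \<le> u (k + l)" for l
    proof (induction l)
      case (Suc l)
      then show ?case
        using incr[of "k + l - i"] i by simp
    qed simp
    from this[of "m - k"] show False
      using um \<open>k \<le> m\<close> \<open>\<not> u k \<le> 1\<close> by simp
  qed
  then show ?thesis
    using \<open>0 < s 0\<close> \<open>0 < a\<close> by (simp add: u_def divide_simps split: if_splits)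
qed


text \<open>Ratios of successive terms increase, so each is at least the first, and multiplying them
  gives the claim. The ratios are compared in product form because terms may vanish.\<close>

lemma log_convex_first_moment:
  fixes s :: "nat \<Rightarrow> real"
  assumes nonneg: "\<And>k. 0 \<le> s k" and logc: "\<And>k. (s (Suc k))\<^sup>2 \<le> s k * s (Suc (Suc k))"
  shows "s 1 ^ Suc k \<le> s 0 ^ k * s (Suc k)"
proof (induction k)
  case (Suc k)
  have ratio: "s 1 * s k \<le> s 0 * s (Suc k)" for k
  proof (induction k)
    case (Suc k)
    show ?case
    proof (cases "s (Suc k) = 0")
      case False
      have "s (Suc k) * (s 1 * s (Suc k)) \<le> s 1 * (s k * s (Suc (Suc k)))"
        using mult_left_mono[OF logc nonneg, of 1 k] by (simp add: power2_eq_square mult_ac)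
      also have "\<dots> \<le> s (Suc k) * (s 0 * s (Suc (Suc k)))"
        using mult_right_mono[OF Suc.IH nonneg, of "Suc (Suc k)"] by (simp add: mult_ac)
      finally show ?thesis
        using False nonneg[of "Suc k"] by (simp add: mult_le_cancel_left)
    qed (simp add: nonneg)
  qed (simp add: mult.commute)
  have "s 1 ^ Suc (Suc k) \<le> s 1 * (s 0 ^ k * s (Suc k))"
    using mult_left_mono[OF Suc.IH nonneg, of 1] by simp
  also have "\<dots> \<le> s 0 ^ k * (s 0 * s (Suc (Suc k)))"
    using mult_left_mono[OF ratio, of "s 0 ^ k" "Suc k"] nonneg by (simp add: mult_ac)
  finally show ?case by (simp add: mult_ac)
qed simp

lemma one_plus_inverse_power_le_exp:
  assumes "0 < m"
  shows "(1 + 1 / real m) ^ m \<le> exp 1"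
proof -
  have "(1 + 1 / real m) ^ m \<le> exp (1 / real m) ^ m"
    by (intro power_mono) auto
  also have "\<dots> = exp 1"
    using assms by (simp add: exp_of_nat_mult[symmetric])
  finally show ?thesis .
qed

text \<open>Log-convexity bounds \<open>s k\<close> by \<open>s 0 * a ^ k\<close> for \<open>k \<le> m\<close>, with equality at \<open>k = m\<close>, and for
  geometric \<open>s\<close> the recursion solves to \<open>s 0 * (a + s 0) ^ m\<close>. The two summands of the bound
  correspond to \<open>m * s 0 \<le> a\<close> and \<open>a \<le> m * s 0\<close>.\<close>

lemma renewal_le:
  fixes s f :: "nat \<Rightarrow> real"
  assumes nonneg: "\<And>k. 0 \<le> s k" and logc: "\<And>k. (s (Suc k))\<^sup>2 \<le> s k * s (Suc (Suc k))"
    and renewal: "\<And>m. f m = s m + (\<Sum>k<m. s k * f (m - Suc k))"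
    and pos: "0 < s 0" and m: "0 < m"
  shows "f m \<le> exp 1 * s m + s 0 * ((real m + 1) * s 0) ^ m"
proof -
  have geom: "f m \<le> s 0 * (a + s 0) ^ m" if a: "0 < a" "s m \<le> s 0 * a ^ m" for a
  proof -
    have "f l \<le> s 0 * (a + s 0) ^ l" if "l \<le> m" for l
      using that
    proof (induction l rule: less_induct)
      case (less l)
      have s: "s k \<le> s 0 * a ^ k" if "k \<le> l" for k
        using log_convex_le_geometric[OF nonneg logc pos a, of k] that less.prems by simp
      have "f l \<le> s 0 * a ^ l + (\<Sum>k<l. (s 0 * a ^ k) * (s 0 * (a + s 0) ^ (l - Suc k)))"
        unfolding renewal[of l] using less a pos nonneg
        by (intro add_mono sum_mono s order_trans[OF mult_left_mono mult_right_mono[OF s]]) auto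
      also have "\<dots> = s 0 * (a ^ l + s 0 * (\<Sum>k<l. a ^ k * (a + s 0) ^ (l - Suc k)))"
        by (simp add: algebra_simps sum_distrib_left)
      also have "s 0 * (\<Sum>k<l. a ^ k * (a + s 0) ^ (l - Suc k)) = (a + s 0) ^ l - a ^ l"
        using power_diff_sumr2[of a l "a + s 0"] by (simp add: mult.commute)
      finally show ?case by simp
    qed
    then show ?thesis by simp
  qed
  show ?thesis
  proof (cases "s m \<le> s 0 * (real m * s 0) ^ m")
    case True
    then have "f m \<le> s 0 * (real m * s 0 + s 0) ^ m"
      using pos m by (intro geom) auto
    also have "real m * s 0 + s 0 = (real m + 1) * s 0"
      by (simp add: algebra_simps)
    finally show ?thesis
      using nonneg[of m] by (smt (verit) mult_nonneg_nonneg exp_ge_zero)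
  next
    case False
    define a where "a = root m (s m / s 0)"
    have am: "a ^ m = s m / s 0"
      using m nonneg pos by (simp add: a_def)
    have "(real m * s 0) ^ m \<le> a ^ m"
      using False pos by (simp add: am pos_le_divide_eq mult.commute)
    then have le: "real m * s 0 \<le> a"
      using m pos nonneg by (subst (asm) power_mono_iff) (auto simp: a_def)
    then have a: "0 < a"
      using m pos by (smt (verit) mult_pos_pos of_nat_0_less_iff)
    have "f m \<le> s 0 * (a + s 0) ^ m"
      using pos by (intro geom a) (simp add: am)
    also have "\<dots> \<le> s 0 * (a * (1 + 1 / real m)) ^ m"
      using a m pos le by (intro mult_left_mono power_mono) (auto simp: field_simps)
    also have "\<dots> = s m * (1 + 1 / real m) ^ m"
      using pos by (simp add: power_mult_distrib am)
    also have "\<dots> \<le> s m * exp 1"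
      by (intro mult_left_mono one_plus_inverse_power_le_exp nonneg m)
    finally show ?thesis
      using pos by (smt (verit) mult.commute mult_nonneg_nonneg zero_le_power of_nat_0_le_iff)
  qed
qed

lemma renewal_ge:
  fixes s f :: "nat \<Rightarrow> real"
  assumes nonneg: "\<And>k. 0 \<le> s k"
    and renewal: "\<And>m. f m = s m + (\<Sum>k<m. s k * f (m - Suc k))"
  shows "s m \<le> f m"
proof -
  have "0 \<le> f m" for m
  proof (induction m rule: less_induct)
    case (less m)
    then show ?case
      unfolding renewal[of m] by (intro add_nonneg_nonneg sum_nonneg mult_nonneg_nonneg nonneg) auto
  qed
  then show ?thesis
    unfolding renewal[of m] using nonneg by (simp add: sum_nonneg)
qed

section \<open>Effect of one extra column on the moments\<close>

lemma frame_moment_insert_ge: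
  assumes "Q \<subseteq> {..<n}" "j < n"
  shows "ip n (X j) ((frame_op n X Q ^^ m) (X j)) \<le> ip n (X j) ((frame_op n X (insert j Q) ^^ m) (X j))"
proof (cases "j \<in> Q")
  case False
  then show ?thesis
    using assms finite_subset[OF assms(1)]
    by (intro renewal_ge[where s = "\<lambda>m. ip n (X j) ((frame_op n X Q ^^ m) (X j))"]
        frame_pow_nonneg frame_pow_insert) auto
qed (simp add: insert_absorb)

text \<open>Frees \<open>j\<close> from being forced into the set: with plain \<open>Q\<close> on
  the right, the moments of all columns refer to the same operator and can be summed.\<close>

lemma frame_moment_insert_le:
  assumes Q: "Q \<subseteq> {..<n}" and j: "j < n" and b: "ip n (X j) (X j) \<le> b"
  shows "ip n (X j) ((frame_op n X (insert j Q) ^^ m) (X j))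
      \<le> exp 1 * ip n (X j) ((frame_op n X Q ^^ m) (X j)) + b * ((real m + 1) * b) ^ m"
proof -
  \<comment> \<open>The expansion needs \<open>j\<close> absent, so \<open>j\<close> is removed even
    if it lies in \<open>Q\<close>; \<open>frame_moment_insert_ge\<close> restores it at the
    end.\<close>
  define R where "R = Q - {j}"
  have R: "R \<subseteq> {..<n}" "finite R" "j \<notin> R" "insert j R = insert j Q"
    using Q finite_subset[OF Q] by (auto simp: R_def)
  define s where "s k = ip n (X j) ((frame_op n X R ^^ k) (X j))" for k
  define f where "f k = ip n (X j) ((frame_op n X (insert j Q) ^^ k) (X j))" for k
  have b0: "0 \<le> b" using b ip_self_nonneg[of n "X j"] by linarith
  have nonneg: "0 \<le> s k" for k
    unfolding s_def by (rule frame_pow_nonneg[OF R(1)])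
  have logc: "(s (Suc k))\<^sup>2 \<le> s k * s (Suc (Suc k))" for k
    unfolding s_def by (rule frame_moments_log_convex[OF R(1)])
  have renewal: "f k = s k + (\<Sum>l<k. s l * f (k - Suc l))" for k
    unfolding s_def f_def R(4)[symmetric] by (rule frame_pow_insert[OF R(2,3)])
  have s0: "s 0 \<le> b" using b by (simp add: s_def)
  have "f m \<le> exp 1 * s m + b * ((real m + 1) * b) ^ m"
  \<comment> \<open>\<open>renewal_le\<close> needs \<open>0 < m\<close> and \<open>0 < s 0\<close>.
    If \<open>s 0 = 0\<close>, then \<open>X j\<close> vanishes on the relevant coordinates, hence
    so does \<open>f m\<close>.\<close>
  proof (cases "m = 0 \<or> s 0 = 0")
    case True
    have "f m = 0" if "s 0 = 0"
      using Cauchy_Schwarz_ip[of n "X j" "(frame_op n X (insert j Q) ^^ m) (X j)"] that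
      by (simp add: f_def s_def)
    moreover have "f m \<le> exp 1 * s m" if "m = 0"
      using that renewal[of 0] nonneg[of 0] mult_right_mono[of 1 "exp 1" "s 0"] by simp
    ultimately show ?thesis
      using True nonneg[of m] b0 by (smt (verit) exp_ge_zero mult_nonneg_nonneg of_nat_0_le_iff zero_le_power)
  next
    case False
    then have "f m \<le> exp 1 * s m + s 0 * ((real m + 1) * s 0) ^ m"
      using nonneg[of 0] by (intro renewal_le nonneg logc renewal) auto
    also have "s 0 * ((real m + 1) * s 0) ^ m \<le> b * ((real m + 1) * b) ^ m"
      using s0 nonneg[of 0] b0 by (intro mult_mono power_mono mult_left_mono) auto
    finally show ?thesis by simp
  qed
  moreover have "s m \<le> ip n (X j) ((frame_op n X Q ^^ m) (X j))"
  proof (cases "j \<in> Q")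
    case True
    then show ?thesis
      using frame_moment_insert_ge[OF R(1) j, of X m] by (simp add: s_def R insert_absorb)
  qed (simp add: s_def R_def)
  ultimately show ?thesis
    unfolding f_def by (smt (verit) mult_left_mono exp_ge_zero)
qed


section \<open>Expectation over a random subset\<close>

lemma expect_subset_add:
  "expect_subset n p (\<lambda>Q. f Q + g Q) = expect_subset n p f + expect_subset n p g"
  by (simp add: expect_subset_def sum.distrib algebra_simps)

lemma expect_subset_scale: "expect_subset n p (\<lambda>Q. c * f Q) = c * expect_subset n p f"
  by (simp add: expect_subset_def sum_distrib_left algebra_simps)

lemma expect_subset_sum:
  "expect_subset n p (\<lambda>Q. \<Sum>j\<in>J. f j Q) = (\<Sum>j\<in>J. expect_subset n p (f j))"
  unfolding expect_subset_def sum_distrib_left by (rule sum.swap)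

lemma expect_subset_mono:
  assumes "0 \<le> p" "p \<le> 1" "\<And>Q. Q \<subseteq> {..<n} \<Longrightarrow> f Q \<le> g Q"
  shows "expect_subset n p f \<le> expect_subset n p g"
  unfolding expect_subset_def using assms by (intro sum_mono mult_left_mono) auto

lemma expect_subset_cong:
  assumes "\<And>Q. Q \<subseteq> {..<n} \<Longrightarrow> f Q = g Q"
  shows "expect_subset n p f = expect_subset n p g"
  unfolding expect_subset_def using assms by (intro sum.cong) auto

lemma expect_subset_const: "expect_subset n p (\<lambda>_. c) = c"
proof -
  have "(\<Sum>Q\<in>Pow {..<n}. p ^ card Q * (1 - p) ^ (n - card Q)) = 1"
    using prod_add[of "{..<n}" "\<lambda>_. p" "\<lambda>_. 1 - p"]
    by (simp add: card_Diff_subset[OF finite_subset] cong: sum.cong_simp)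
  then show ?thesis
    by (simp add: expect_subset_def sum_distrib_right[symmetric])
qed

text \<open>Pair each \<open>Q\<close> avoiding \<open>j\<close> with \<open>insert j Q\<close>: the
  weight of the latter is \<open>p\<close> times the total weight of the pair.\<close>

lemma expect_subset_insert:
  assumes "j < n"
  shows "expect_subset n p (\<lambda>Q. if j \<in> Q then g Q else 0) = p * expect_subset n p (\<lambda>Q. g (insert j Q))"
proof -
  let ?N = "{..<n} - {j}"
  let ?w = "\<lambda>Q. p ^ card Q * (1 - p) ^ (n - card Q)"
  have N: "{..<n} = insert j ?N" using assms by auto
  have split: "(\<Sum>Q\<in>Pow {..<n}. h Q) = (\<Sum>Q\<in>Pow ?N. h Q + h (insert j Q))" for h :: "nat set \<Rightarrow> real"
  proof -
    have "inj_on (insert j) (Pow ?N)"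
      by (auto simp: inj_on_def)
    then show ?thesis
      by (subst N, subst Pow_insert, subst sum.union_disjoint) (auto simp: sum.reindex sum.distrib)
  qed
  have "?w Q * (if j \<in> Q then g Q else 0) + ?w (insert j Q) * g (insert j Q)
      = p * (?w Q * g (insert j Q) + ?w (insert j Q) * g (insert j Q))" if "Q \<in> Pow ?N" for Q
  proof -
    have "finite Q" "j \<notin> Q" "card Q \<le> card ?N"
      using that by (auto intro: finite_subset card_mono)
    then have "card (insert j Q) = Suc (card Q)" "n - card Q = Suc (n - Suc (card Q))"
      using assms by auto
    then show ?thesis using \<open>j \<notin> Q\<close> by (simp add: algebra_simps)
  qed
  then show ?thesis
    unfolding expect_subset_def split sum_distrib_left by (intro sum.cong) auto
qed

lemma expect_subset_sum_over:
  "expect_subset n p (\<lambda>Q. \<Sum>j\<in>Q. g j Q) = p * (\<Sum>j<n. expect_subset n p (\<lambda>Q. g j (insert j Q)))"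
proof -
  have "expect_subset n p (\<lambda>Q. \<Sum>j\<in>Q. g j Q)
      = expect_subset n p (\<lambda>Q. \<Sum>j<n. if j \<in> Q then g j Q else 0)"
    by (intro expect_subset_cong) (simp add: sum.If_cases Int_absorb1)
  then show ?thesis
    by (simp add: expect_subset_sum expect_subset_insert sum_distrib_left)
qed

section \<open>Recursion for the expected trace\<close>

text \<open>The factor \<open>exp 1\<close> and the last summand are the cost of
  \<open>frame_moment_insert_le\<close>. After it all columns, drawn or not, are tested against the
  same \<open>Q\<close>, and \<open>frame_bound_tr\<close> turns their sum back into a
  trace.\<close>

lemma expect_frame_tr_Suc:
  assumes p: "0 \<le> p" "p \<le> 1"
    and frame: "\<And>y. (\<Sum>j<n. (ip n (X j) y)\<^sup>2) \<le> c * ip n y y"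
    and b: "\<And>j. j < n \<Longrightarrow> ip n (X j) (X j) \<le> b"
  shows "expect_subset n p (\<lambda>Q. frame_tr n X Q (Suc m))
    \<le> exp 1 * p * c * expect_subset n p (\<lambda>Q. frame_tr n X Q m) + p * n * b * ((real m + 1) * b) ^ m"
proof -
  let ?g = "\<lambda>j Q. ip n (X j) ((frame_op n X Q ^^ m) (X j))"
  let ?r = "b * ((real m + 1) * b) ^ m"
  have "(\<Sum>j<n. expect_subset n p (\<lambda>Q. ?g j (insert j Q)))
      \<le> (\<Sum>j<n. expect_subset n p (\<lambda>Q. exp 1 * ?g j Q + ?r))"
    using p b by (intro sum_mono expect_subset_mono frame_moment_insert_le) auto
  also have "\<dots> = exp 1 * expect_subset n p (\<lambda>Q. \<Sum>j<n. ?g j Q) + n * ?r"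
    by (simp add: expect_subset_add expect_subset_scale expect_subset_const expect_subset_sum
        sum.distrib sum_distrib_left)
  also have "\<dots> \<le> exp 1 * expect_subset n p (\<lambda>Q. c * frame_tr n X Q m) + n * ?r"
    using p by (intro add_right_mono mult_left_mono expect_subset_mono frame_bound_tr frame) auto
  finally show ?thesis
    unfolding frame_tr_Suc expect_subset_sum_over
    using mult_left_mono[OF _ p(1)] by (fastforce simp: expect_subset_scale algebra_simps)
qed

lemma expect_frame_tr_le:
  assumes p: "0 \<le> p" "p \<le> 1"
    and frame: "\<And>y. (\<Sum>j<n. (ip n (X j) y)\<^sup>2) \<le> c * ip n y y"
    and b: "\<And>j. j < n \<Longrightarrow> ip n (X j) (X j) \<le> b" "0 \<le> b"
    and M: "exp 1 * p * c \<le> M" "real P * b \<le> M" and P: "0 < P"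
  shows "expect_subset n p (\<lambda>Q. frame_tr n X Q P) \<le> p * n * M ^ P"
proof -
  have M0: "0 \<le> M" using M(2) b(2) by (smt (verit) mult_nonneg_nonneg of_nat_0_le_iff)
  have E0: "0 \<le> expect_subset n p (\<lambda>Q. frame_tr n X Q m)" for m
    using expect_subset_mono[of p n "\<lambda>_. 0" "\<lambda>Q. frame_tr n X Q m"] p
    by (simp add: frame_tr_nonneg expect_subset_const)
  \<comment> \<open>The induction starts at the first power, since the zeroth has trace
    \<open>n\<close> without the factor \<open>p\<close>. \<open>Suc m\<close> counts the remainders
    collected so far; at the end \<open>real P * b \<le> M\<close> absorbs it.\<close>
  have "expect_subset n p (\<lambda>Q. frame_tr n X Q (Suc m)) \<le> Suc m * (p * n * b * M ^ m)" if "m < P" for m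
    using that
  proof (induction m)
    case 0
    have "(\<Sum>j<n. ip n (X j) (X j)) \<le> (\<Sum>j<n. b)"
      by (intro sum_mono b) auto
    then show ?case
      using p by (simp add: frame_tr_Suc expect_subset_sum_over expect_subset_const mult_left_mono mult.assoc)
  next
    case (Suc m)
    have "expect_subset n p (\<lambda>Q. frame_tr n X Q (Suc (Suc m)))
      \<le> exp 1 * p * c * expect_subset n p (\<lambda>Q. frame_tr n X Q (Suc m))
        + p * n * b * ((real (Suc m) + 1) * b) ^ Suc m"
      by (intro expect_frame_tr_Suc p frame b)
    also have "\<dots> \<le> M * (Suc m * (p * n * b * M ^ m)) + p * n * b * M ^ Suc m"
    proof (intro add_mono mult_left_mono power_mono)
      show "exp 1 * p * c * expect_subset n p (\<lambda>Q. frame_tr n X Q (Suc m)) \<le> M * (Suc m * (p * n * b * M ^ m))"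
        using Suc M M0 E0 by (intro mult_mono) auto
      show "(real (Suc m) + 1) * b \<le> M"
        using Suc.prems b(2) by (intro order_trans[OF mult_right_mono M(2)]) auto
    qed (use p b in auto)
    also have "\<dots> = Suc (Suc m) * (p * n * b * M ^ Suc m)"
      by (simp add: algebra_simps)
    finally show ?case .
  qed
  from this[of "P - 1"] have "expect_subset n p (\<lambda>Q. frame_tr n X Q P) \<le> p * n * M ^ (P - 1) * (P * b)"
    using P by (simp add: algebra_simps)
  also have "\<dots> \<le> p * n * M ^ (P - 1) * M"
    using p M0 by (intro mult_left_mono M) auto
  also have "\<dots> = p * n * M ^ P"
    using P by (cases P) simp_all
  finally show ?thesis .
qed

section \<open>The spectral norm\<close>

lemma mat_vec_norm_L2: "mat_vec_norm n A x = L2_set (\<lambda>i. \<Sum>j<n. A i j * x j) {..<n}"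
  by (simp add: mat_vec_norm_def L2_set_def)

lemma mat_vec_norm_nonneg: "0 \<le> mat_vec_norm n A x"
  by (simp add: mat_vec_norm_def sum_nonneg)

lemma col_norm_nonneg: "0 \<le> col_norm n A j"
  by (simp add: col_norm_def sum_nonneg)

lemma L2_set_sum_le: "L2_set (\<lambda>i. \<Sum>j\<in>J. f j i) I \<le> (\<Sum>j\<in>J. L2_set (f j) I)"
proof (induction J rule: infinite_finite_induct)
  case (insert j J)
  then show ?case
    using L2_set_triangle_ineq[of "f j" "\<lambda>i. \<Sum>j\<in>J. f j i" I] by simp
qed (simp_all add: L2_set_def)

text \<open>A crude triangle inequality with two uses: it makes the supremum in
  \<open>spec_norm\<close> finite, and it controls the few long columns.\<close>

lemma mat_vec_norm_le_col_norms:
  assumes "(\<Sum>j<n. (x j)\<^sup>2) \<le> 1"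
  shows "mat_vec_norm n A x \<le> (\<Sum>j<n. col_norm n A j)"
proof -
  have "mat_vec_norm n A x \<le> (\<Sum>j<n. L2_set (\<lambda>i. A i j * x j) {..<n})"
    unfolding mat_vec_norm_L2 by (rule L2_set_sum_le)
  also have "\<dots> \<le> (\<Sum>j<n. col_norm n A j)"
  proof (rule sum_mono)
    fix j assume "j \<in> {..<n}"
    then have "(x j)\<^sup>2 \<le> (\<Sum>j<n. (x j)\<^sup>2)"
      by (intro member_le_sum) auto
    then have "\<bar>x j\<bar> \<le> 1"
      using assms by (simp flip: abs_square_le_1)
    moreover have "L2_set (\<lambda>i. A i j * x j) {..<n} = \<bar>x j\<bar> * col_norm n A j"
      by (simp add: L2_set_def col_norm_def power_mult_distrib sum_distrib_right[symmetric]
          real_sqrt_mult)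
    ultimately show "L2_set (\<lambda>i. A i j * x j) {..<n} \<le> col_norm n A j"
      using mult_right_mono[OF _ col_norm_nonneg] by fastforce
  qed
  finally show ?thesis .
qed

lemma mat_vec_norm_le_spec_norm:
  assumes "(\<Sum>j<n. (x j)\<^sup>2) \<le> 1"
  shows "mat_vec_norm n A x \<le> spec_norm n A"
  unfolding spec_norm_def
proof (rule cSup_upper)
  show "bdd_above {mat_vec_norm n A x |x. (\<Sum>j<n. (x j)\<^sup>2) \<le> 1}"
    using mat_vec_norm_le_col_norms by (intro bdd_aboveI) auto
qed (use assms in auto)

lemma spec_norm_least:
  assumes "\<And>x. (\<Sum>j<n. (x j)\<^sup>2) \<le> 1 \<Longrightarrow> mat_vec_norm n A x \<le> K"
  shows "spec_norm n A \<le> K"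
  unfolding spec_norm_def
proof (rule cSup_least)
  show "{mat_vec_norm n A x |x. (\<Sum>j<n. (x j)\<^sup>2) \<le> 1} \<noteq> {}"
    by (auto intro!: exI[of _ "\<lambda>_. 0"])
qed (use assms in auto)

lemma spec_norm_nonneg: "0 \<le> spec_norm n A"
  using mat_vec_norm_le_spec_norm[of "\<lambda>_. 0" n A] mat_vec_norm_nonneg[of n A "\<lambda>_. 0"] by simp

lemma mat_vec_norm_scale: "mat_vec_norm n A (\<lambda>j. c * x j) = \<bar>c\<bar> * mat_vec_norm n A x"
proof -
  have "(\<Sum>j<n. A i j * (c * x j)) = c * (\<Sum>j<n. A i j * x j)" for i
    by (simp add: sum_distrib_left algebra_simps)
  then show ?thesis
    by (simp add: mat_vec_norm_def power_mult_distrib sum_distrib_left[symmetric] real_sqrt_mult)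
qed

lemma mat_vec_norm_le: "mat_vec_norm n A x \<le> spec_norm n A * sqrt (\<Sum>j<n. (x j)\<^sup>2)"
proof -
  define r where "r = sqrt (\<Sum>j<n. (x j)\<^sup>2)"
  have r: "r\<^sup>2 = (\<Sum>j<n. (x j)\<^sup>2)" "0 \<le> r"
    by (simp_all add: r_def sum_nonneg)
  show ?thesis
  proof (cases "r = 0")
    case True
    then have "\<forall>j<n. x j = 0"
      using r by (simp add: sum_nonneg_eq_0_iff)
    then show ?thesis by (simp add: mat_vec_norm_def)
  next
    case False
    have "(\<Sum>j<n. (inverse r * x j)\<^sup>2) = 1"
      using False by (simp add: power_mult_distrib sum_distrib_left[symmetric] r(1)[symmetric] power_inverse)
    then have "inverse r * mat_vec_norm n A x \<le> spec_norm n A"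
      using mat_vec_norm_le_spec_norm[of "\<lambda>j. inverse r * x j" n A] r by (simp add: mat_vec_norm_scale)
    then show ?thesis
      using False r(2) by (simp add: r_def[symmetric] field_simps)
  qed
qed

text \<open>That is, the transpose has norm at most \<open>spec_norm n A\<close>.\<close>

lemma spec_norm_frame_bound:
  "(\<Sum>j<n. (ip n (\<lambda>i. A i j) y)\<^sup>2) \<le> (spec_norm n A)\<^sup>2 * ip n y y"
proof -
  define z where "z j = ip n (\<lambda>i. A i j) y" for j
  define Z where "Z = (\<Sum>j<n. (z j)\<^sup>2)"
  define w where "w i = (\<Sum>j<n. z j * A i j)" for i
  have Z0: "0 \<le> Z" by (simp add: Z_def sum_nonneg)
  have "ip n y w = Z"
    unfolding w_def ip_sum_right Z_def by (simp add: z_def ip_commute power2_eq_square)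
  then have "Z\<^sup>2 \<le> ip n y y * ip n w w"
    using Cauchy_Schwarz_ip by metis
  also have "ip n w w = (mat_vec_norm n A z)\<^sup>2"
    by (simp add: mat_vec_norm_def ip_self_eq w_def mult.commute sum_nonneg)
  finally have "Z\<^sup>2 \<le> ip n y y * (mat_vec_norm n A z)\<^sup>2" .
  also have "\<dots> \<le> ip n y y * (spec_norm n A * sqrt Z)\<^sup>2"
    unfolding Z_def by (intro mult_left_mono power_mono mat_vec_norm_le mat_vec_norm_nonneg ip_self_nonneg)
  also have "\<dots> = ((spec_norm n A)\<^sup>2 * ip n y y) * Z"
    using Z0 by (simp add: power_mult_distrib)
  finally have "Z * Z \<le> ((spec_norm n A)\<^sup>2 * ip n y y) * Z"
    by (simp only: power2_eq_square)
  then have "Z \<le> (spec_norm n A)\<^sup>2 * ip n y y"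
    using Z0 ip_self_nonneg[of n y] by (cases "Z = 0") (simp_all add: mult_le_cancel_right)
  then show ?thesis by (simp add: Z_def z_def)
qed

section \<open>Comparison of the spectral norm with the trace\<close>

text \<open>Replaces the largest eigenvalue by the moments \<open>s k\<close> of a vector
  \<open>y\<close> in the image of the unit ball. The chain is \<open>s 0 ^ 2 \<le> s 1\<close>,
  \<open>s 1 ^ m \<le> s 0 ^ (m - 1) * s m\<close> and \<open>s m \<le> s 0 * ?T\<close>; cancelling
  leaves \<open>s 0 ^ m \<le> ?T\<close>.\<close>

lemma spec_norm_restrict_power_le_tr:
  assumes Q: "Q \<subseteq> {..<n}" and m: "0 < m"
  shows "spec_norm n (restrict_cols A Q) ^ (2 * m) \<le> frame_tr n (\<lambda>j i. A i j) Q m"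
proof -
  let ?X = "\<lambda>j i. A i j"
  let ?T = "frame_tr n ?X Q m"
  have T0: "0 \<le> ?T" by (rule frame_tr_nonneg[OF Q])
  have bound: "mat_vec_norm n (restrict_cols A Q) x \<le> root (2 * m) ?T" if x: "(\<Sum>j<n. (x j)\<^sup>2) \<le> 1" for x
  proof -
    define y where "y i = (\<Sum>j\<in>Q. x j * ?X j i)" for i
    define s where "s k = ip n y ((frame_op n ?X Q ^^ k) y)" for k
    have nonneg: "0 \<le> s k" for k unfolding s_def by (rule frame_pow_nonneg[OF Q])
    have logc: "(s (Suc k))\<^sup>2 \<le> s k * s (Suc (Suc k))" for k
      unfolding s_def by (rule frame_moments_log_convex[OF Q])
    have "(\<Sum>j<n. restrict_cols A Q i j * x j) = y i" for i
      unfolding y_def using Q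
      by (intro sum.mono_neutral_cong_right) (auto simp: restrict_cols_def)
    then have norm: "(mat_vec_norm n (restrict_cols A Q) x)\<^sup>2 = s 0"
      by (simp add: mat_vec_norm_def s_def ip_self_eq sum_nonneg)
    \<comment> \<open>Moving the matrix to the other side pairs \<open>x\<close> with the transpose
      applied to \<open>y\<close>, whose squared length is \<open>s 1\<close>.\<close>
    have "s 0 = ip n y (\<lambda>i. \<Sum>j\<in>Q. x j * ?X j i)"
      by (simp add: s_def flip: y_def)
    also have "\<dots> = (\<Sum>j\<in>Q. x j * ip n (?X j) y)"
      unfolding ip_sum_right by (simp add: ip_commute)
    finally have "(s 0)\<^sup>2 \<le> (\<Sum>j\<in>Q. (x j)\<^sup>2) * (\<Sum>j\<in>Q. (ip n (?X j) y)\<^sup>2)"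
      by (simp add: Cauchy_Schwarz_ineq_sum)
    also have "\<dots> \<le> 1 * (\<Sum>j\<in>Q. (ip n (?X j) y)\<^sup>2)"
    proof (intro mult_right_mono sum_nonneg)
      have "(\<Sum>j\<in>Q. (x j)\<^sup>2) \<le> (\<Sum>j<n. (x j)\<^sup>2)"
        using Q by (intro sum_mono2) auto
      then show "(\<Sum>j\<in>Q. (x j)\<^sup>2) \<le> 1" using x by simp
    qed auto
    also have "\<dots> = s 1"
      by (simp add: s_def ip_frame_op power2_eq_square)
    finally have "(s 0)\<^sup>2 ^ m \<le> s 1 ^ m"
      by (intro power_mono) auto
    also have "\<dots> \<le> s 0 ^ (m - 1) * s m"
      using log_convex_first_moment[of s "m - 1", OF nonneg logc] m by simp
    also have "\<dots> \<le> s 0 ^ (m - 1) * (s 0 * ?T)"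
      using frame_pow_le_tr[OF Q, where u = y and X = ?X and m = m] nonneg[of 0] by (intro mult_left_mono) (auto simp: s_def)
    also have "\<dots> = s 0 ^ m * ?T"
      using m by (cases m) simp_all
    finally have "s 0 ^ m * s 0 ^ m \<le> s 0 ^ m * ?T"
      by (simp add: power_mult[symmetric] power_add[symmetric] mult_2)
    then have "s 0 ^ m \<le> ?T"
      using nonneg[of 0] T0 m by (cases "s 0 = 0") (auto simp: zero_power)
    then have "mat_vec_norm n (restrict_cols A Q) x ^ (2 * m) \<le> ?T"
      by (simp add: power_mult norm)
    then show ?thesis
      using m real_root_le_mono[of "2 * m"] real_root_power_cancel[of "2 * m"] mat_vec_norm_nonneg
      by (metis mult_pos_pos zero_less_numeral)
  qed
  have "spec_norm n (restrict_cols A Q) ^ (2 * m) \<le> root (2 * m) ?T ^ (2 * m)"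
    by (intro power_mono spec_norm_least bound spec_norm_nonneg)
  then show ?thesis using T0 m by simp
qed

lemma spec_norm_restrict_le_col_norms:
  assumes "Q \<subseteq> {..<n}"
  shows "spec_norm n (restrict_cols A Q) \<le> (\<Sum>j\<in>Q. col_norm n A j)"
proof (rule spec_norm_least)
  fix x :: "nat \<Rightarrow> real" assume "(\<Sum>j<n. (x j)\<^sup>2) \<le> 1"
  then have "mat_vec_norm n (restrict_cols A Q) x \<le> (\<Sum>j<n. col_norm n (restrict_cols A Q) j)"
    by (rule mat_vec_norm_le_col_norms)
  also have "\<dots> = (\<Sum>j\<in>Q. col_norm n A j)"
    using assms by (intro sum.mono_neutral_cong_right) (auto simp: restrict_cols_def col_norm_def)
  finally show "mat_vec_norm n (restrict_cols A Q) x \<le> (\<Sum>j\<in>Q. col_norm n A j)" .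
qed

lemma spec_norm_restrict_le: "spec_norm n (restrict_cols A S) \<le> spec_norm n A"
proof (rule spec_norm_least)
  fix x :: "nat \<Rightarrow> real" assume x: "(\<Sum>j<n. (x j)\<^sup>2) \<le> 1"
  define y where "y j = (if j \<in> S then x j else 0)" for j
  have "(\<Sum>j<n. (y j)\<^sup>2) \<le> (\<Sum>j<n. (x j)\<^sup>2)"
    by (intro sum_mono) (auto simp: y_def)
  then have "mat_vec_norm n A y \<le> spec_norm n A"
    using x by (intro mat_vec_norm_le_spec_norm) auto
  moreover have "restrict_cols A S i j * x j = A i j * y j" for i j
    by (simp add: y_def restrict_cols_def)
  ultimately show "mat_vec_norm n (restrict_cols A S) x \<le> spec_norm n A"
    by (simp add: mat_vec_norm_def)
qed

lemma spec_norm_triangle: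
  "spec_norm n (\<lambda>i j. A i j + B i j) \<le> spec_norm n A + spec_norm n B"
proof (rule spec_norm_least)
  fix x :: "nat \<Rightarrow> real" assume x: "(\<Sum>j<n. (x j)\<^sup>2) \<le> 1"
  have "mat_vec_norm n (\<lambda>i j. A i j + B i j) x \<le> mat_vec_norm n A x + mat_vec_norm n B x"
    unfolding mat_vec_norm_L2 distrib_right sum.distrib by (rule L2_set_triangle_ineq)
  then show "mat_vec_norm n (\<lambda>i j. A i j + B i j) x \<le> spec_norm n A + spec_norm n B"
    using mat_vec_norm_le_spec_norm[OF x, of A] mat_vec_norm_le_spec_norm[OF x, of B] by linarith
qed

section \<open>Matrices with bounded columns\<close>

lemma expect_spec_norm_restrict_le:
  assumes q: "1 < q" "q \<le> real n" and \<beta>: "\<And>j. j < n \<Longrightarrow> col_norm n A j \<le> \<beta>" "0 \<le> \<beta>"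
  shows "expect_subset n (q / real n) (\<lambda>Q. spec_norm n (restrict_cols A Q))
    \<le> 2 * sqrt (exp 1 * (exp 1 * (q / real n) * (spec_norm n A)\<^sup>2 + real (nat \<lceil>ln q\<rceil>) * \<beta>\<^sup>2))"
proof -
  define p where "p = q / real n"
  define P where "P = nat \<lceil>ln q\<rceil>"
  \<comment> \<open>Being a sum, \<open>M\<close> dominates both quantities required by
    \<open>expect_frame_tr_le\<close>.\<close>
  define M where "M = exp 1 * p * (spec_norm n A)\<^sup>2 + real P * \<beta>\<^sup>2"
  \<comment> \<open>Then \<open>K ^ (2 * P)\<close> equals \<open>exp 1 ^ P * M ^ P\<close>, and
    \<open>exp 1 ^ P\<close> absorbs the factor \<open>p * n = q\<close> of the moment
    bound.\<close>
  define K where "K = sqrt (exp 1 * M)"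
  let ?X = "\<lambda>j i. A i j"
  have p: "0 \<le> p" "p \<le> 1" "p * real n = q"
    using q by (auto simp: p_def)
  have "0 < ln q" using q by simp
  then have P: "0 < P" "ln q \<le> real P" by (auto simp: P_def)
  have "q = exp (ln q)" using q by simp
  also have "\<dots> \<le> exp 1 ^ P" using P by (simp flip: exp_of_nat_mult)
  finally have qP: "q \<le> exp 1 ^ P" .
  have b: "ip n (?X j) (?X j) \<le> \<beta>\<^sup>2" if "j < n" for j
  proof -
    have "ip n (?X j) (?X j) = (col_norm n A j)\<^sup>2"
      by (simp add: ip_self_eq col_norm_def sum_nonneg)
    then show ?thesis using \<beta>(1)[OF that] col_norm_nonneg by (simp add: power_mono)
  qed
  have M0: "0 \<le> M" using p by (simp add: M_def)
  have "expect_subset n p (\<lambda>Q. spec_norm n (restrict_cols A Q)) \<le> 2 * K"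
  \<comment> \<open>Split off because \<open>K\<close> becomes a divisor. If \<open>M = 0\<close>
    then \<open>\<beta> = 0\<close>, and every column vanishes.\<close>
  proof (cases "M = 0")
    case True
    then have "real P * \<beta>\<^sup>2 \<le> 0"
      using p unfolding M_def by (smt (verit) exp_ge_zero mult_nonneg_nonneg zero_le_power2)
    then have "\<beta> = 0" using P by (simp add: mult_le_0_iff)
    then have "spec_norm n (restrict_cols A Q) \<le> 0" if "Q \<subseteq> {..<n}" for Q
      using spec_norm_restrict_le_col_norms[OF that, of A] sum_nonpos[of Q "col_norm n A"] \<beta> that
      by fastforce
    then show ?thesis
      using expect_subset_mono[of p n "\<lambda>Q. spec_norm n (restrict_cols A Q)" "\<lambda>_. 0"] p True
      by (simp add: expect_subset_const K_def)
  next
    case False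
    then have Mpos: "0 < M" and Kpos: "0 < K" using M0 by (auto simp: K_def)
    have K2: "K ^ (2 * P) = exp 1 ^ P * M ^ P"
      using M0 by (simp add: K_def power_mult power_mult_distrib)
    have "spec_norm n (restrict_cols A Q) \<le> K + K / K ^ (2 * P) * frame_tr n ?X Q P"
      if Q: "Q \<subseteq> {..<n}" for Q
    proof -
      let ?s = "spec_norm n (restrict_cols A Q)"
      \<comment> \<open>This elementary bound takes the place of Jensen's inequality; its two
        summands cause the factor 2 in the conclusion.\<close>
      have "?s \<le> K + K * (?s / K) ^ (2 * P)"
      proof (cases "?s \<le> K")
        case True
        then show ?thesis
          using Kpos spec_norm_nonneg by (simp add: add_increasing2)
      next
        case False
        then have "?s / K \<le> (?s / K) ^ (2 * P)"
          using Kpos P by (intro self_le_power) auto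
        then have "K * (?s / K) \<le> K * (?s / K) ^ (2 * P)"
          using Kpos by (intro mult_left_mono) auto
        then show ?thesis using Kpos by simp
      qed
      also have "\<dots> = K + K / K ^ (2 * P) * ?s ^ (2 * P)"
        by (simp add: power_divide)
      also have "\<dots> \<le> K + K / K ^ (2 * P) * frame_tr n ?X Q P"
        using Kpos P by (intro add_left_mono mult_left_mono spec_norm_restrict_power_le_tr Q) auto
      finally show ?thesis .
    qed
    then have "expect_subset n p (\<lambda>Q. spec_norm n (restrict_cols A Q))
        \<le> expect_subset n p (\<lambda>Q. K + K / K ^ (2 * P) * frame_tr n ?X Q P)"
      using p by (intro expect_subset_mono) auto
    also have "\<dots> = K + K / K ^ (2 * P) * expect_subset n p (\<lambda>Q. frame_tr n ?X Q P)"
      by (simp only: expect_subset_add expect_subset_const expect_subset_scale)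
    also have "\<dots> \<le> K + K / K ^ (2 * P) * (p * n * M ^ P)"
      using p b P Kpos
      by (intro add_left_mono mult_left_mono
          expect_frame_tr_le[where c = "(spec_norm n A)\<^sup>2" and b = "\<beta>\<^sup>2"] spec_norm_frame_bound)
         (auto simp: M_def)
    also have "\<dots> = K + K * (q / exp 1 ^ P)"
      using Mpos p by (simp add: K2)
    also have "\<dots> \<le> K + K * 1"
      using Kpos qP by (intro add_left_mono mult_left_mono) auto
    finally show ?thesis by simp
  qed
  then show ?thesis by (simp add: K_def M_def p_def P_def)
qed


section \<open>Sorted column lengths and the number of long columns\<close>

text \<open>With \<open>t\<close> the \<open>m\<close>-th largest entry, both sides are compared with \<open>m t + \<Sum>\<^sub>j max 0 (a\<^sub>j - t)\<close>, which
  does not depend on the order of the entries.\<close>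

lemma sum_le_sum_list_take_sorted_desc:
  fixes a :: "nat \<Rightarrow> real"
  assumes L: "L \<subseteq> {..<n}" "card L \<le> m" and m: "0 < m" "m \<le> n"
    and nonneg: "\<And>j. j < n \<Longrightarrow> 0 \<le> a j"
  shows "sum a L \<le> sum_list (take m (rev (sort (map a [0..<n]))))"
proof -
  define xs where "xs = rev (sort (map a [0..<n]))"
  define t where "t = xs ! (m - 1)"
  have len: "length xs = n" and set: "set xs = a ` {..<n}"
    by (auto simp: xs_def)
  have "sorted (rev xs)" by (simp add: xs_def)
  then have desc: "xs ! j \<le> xs ! i" if "i \<le> j" "j < n" for i j
    using that len by (simp add: sorted_rev_nth_mono)
  have "t \<in> set xs" using len m by (simp add: t_def)
  then have t0: "0 \<le> t" using nonneg by (auto simp: set)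
  define h where "h x = max 0 (x - t)" for x
  have h_take: "map h (take m xs) = map (\<lambda>x. x - t) (take m xs)"
    using desc m len by (auto simp: h_def t_def in_set_conv_nth intro!: desc)
  have h_drop: "map h (drop m xs) = map (\<lambda>x. 0) (drop m xs)"
    using desc m len by (auto simp: h_def t_def in_set_conv_nth intro!: desc)
  have "(\<Sum>j<n. h (a j)) = sum_list (map h (map a [0..<n]))"
    by (simp add: sum_list_distinct_conv_sum_set comp_def atLeast0LessThan)
  also have "\<dots> = sum_list (map h xs)"
    by (simp only: sum_mset_sum_list[symmetric] mset_map xs_def mset_rev mset_sort)
  also have "\<dots> = sum_list (map h (take m xs)) + sum_list (map h (drop m xs))"
    by (metis append_take_drop_id map_append sum_list_append)
  also have "\<dots> = sum_list (take m xs) - m * t"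
    unfolding h_take h_drop using m len by (simp add: sum_list_subtractf sum_list_triv)
  finally have h_sum: "(\<Sum>j<n. h (a j)) = sum_list (take m xs) - m * t" .
  have "sum a L \<le> (\<Sum>j\<in>L. t + h (a j))"
    by (intro sum_mono) (auto simp: h_def)
  also have "\<dots> = card L * t + (\<Sum>j\<in>L. h (a j))"
    by (simp add: sum.distrib)
  also have "\<dots> \<le> m * t + (\<Sum>j<n. h (a j))"
    using L t0 by (intro add_mono mult_right_mono sum_mono2) (auto simp: h_def)
  finally show ?thesis by (simp add: h_sum xs_def)
qed

lemma knorm_nonneg:
  assumes "0 < k"
  shows "0 \<le> knorm n k A"
proof -
  have "0 \<le> sum_list (take m (sorted_col_norms n A))" for m
    by (intro sum_list_nonneg) (auto simp: sorted_col_norms_def col_norm_nonneg dest!: in_set_takeD)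
  then show ?thesis using assms by (simp add: knorm_def)
qed

lemma sum_col_norm_le_knorm:
  assumes "1 \<le> k" "k \<le> real n" "L \<subseteq> {..<n}" "card L \<le> nat \<lfloor>k\<rfloor>"
  shows "(\<Sum>j\<in>L. col_norm n A j) \<le> k * knorm n k A"
proof -
  have "(\<Sum>j\<in>L. col_norm n A j) \<le> sum_list (take (nat \<lfloor>k\<rfloor>) (sorted_col_norms n A))"
    unfolding sorted_col_norms_def using assms
    by (intro sum_le_sum_list_take_sorted_desc) (auto simp: col_norm_nonneg, linarith+)
  then show ?thesis using assms by (simp add: knorm_def)
qed

text \<open>Otherwise \<open>nat \<lfloor>k\<rfloor>\<close> of these columns alone would have total
  length above \<open>k * knorm n k A\<close>. The factor 2 in the threshold pays for rounding:
  \<open>k \<le> 2 * \<lfloor>k\<rfloor>\<close> because \<open>1 \<le> k\<close>.\<close>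

lemma card_large_cols_le:
  assumes k: "1 \<le> k" "k \<le> real n"
  shows "card {j. j < n \<and> 2 * knorm n k A < col_norm n A j} \<le> nat \<lfloor>k\<rfloor>"
proof (rule ccontr)
  let ?m = "nat \<lfloor>k\<rfloor>" and ?L = "{j. j < n \<and> 2 * knorm n k A < col_norm n A j}"
  assume "\<not> card ?L \<le> ?m"
  then obtain S where S: "S \<subseteq> ?L" "card S = ?m"
    by (metis nat_le_linear obtain_subset_with_card_n)
  have "1 \<le> \<lfloor>k\<rfloor>" using k by simp
  then have m: "0 < ?m" "k \<le> 2 * real ?m" by (simp, simp, linarith)
  have "k * knorm n k A \<le> real ?m * (2 * knorm n k A)"
    using mult_right_mono[OF m(2) knorm_nonneg[of k n A]] k by simp
  also have "\<dots> = (\<Sum>j\<in>S. 2 * knorm n k A)"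
    by (simp add: S)
  also have "\<dots> < (\<Sum>j\<in>S. col_norm n A j)"
    using S m card_gt_0_iff[of S] by (intro sum_strict_mono) auto
  also have "\<dots> \<le> k * knorm n k A"
    using S by (intro sum_col_norm_le_knorm k) auto
  finally show False by simp
qed

section \<open>Splitting off the long columns\<close>

theorem theorem1p4:
  shows "\<exists>C>0. \<forall>(n::nat) (A::nat \<Rightarrow> nat \<Rightarrow> real) (q::real).
           2 < q \<and> q \<le> real n \<longrightarrow>
           expect_subset n (q / real n) (\<lambda>Q. spec_norm n (restrict_cols A Q))
             \<le> C * (sqrt (q / real n) * spec_norm n A + sqrt (ln q) * knorm n (real n / q) A)"
\<comment> \<open>14 is 12 + 2: the short columns give \<open>12 * (sqrt (ln q) * \<kappa>)\<close>,
  the long ones \<open>\<kappa>\<close>, which is at most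
  \<open>2 * (sqrt (ln q) * \<kappa>)\<close>. The spectral term needs only 6.\<close>
proof (intro exI[of _ "14 :: real"] conjI allI impI)
  fix n :: nat and A :: "nat \<Rightarrow> nat \<Rightarrow> real" and q :: real
  assume q: "2 < q \<and> q \<le> real n"
  define p where "p = q / real n"
  define k where "k = real n / q"
  define \<kappa> where "\<kappa> = knorm n k A"
  define L where "L = {j. j < n \<and> 2 * \<kappa> < col_norm n A j}"
  define B where "B = restrict_cols A (- L)"
  define P where "P = real (nat \<lceil>ln q\<rceil>)"
  have p: "0 \<le> p" "p \<le> 1" "p * k = 1" and k: "1 \<le> k" "k \<le> real n"
    using q by (auto simp: p_def k_def field_simps)
  have \<kappa>: "0 \<le> \<kappa>" using k by (simp add: \<kappa>_def knorm_nonneg)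
  have L: "L \<subseteq> {..<n}" by (auto simp: L_def)
  have L_sum: "(\<Sum>j\<in>L. col_norm n A j) \<le> k * \<kappa>"
    unfolding \<kappa>_def using card_large_cols_le[OF k, of A]
    by (intro sum_col_norm_le_knorm k L) (simp add: L_def \<kappa>_def)
  have "ln 2 \<le> ln q" using q by simp
  then have lnq: "1 / 2 \<le> ln q" using ln2_ge_two_thirds by linarith
  \<comment> \<open>Rounding up adds at most 1, and \<open>1 \<le> 2 * ln q\<close>.\<close>
  have P: "P \<le> 3 * ln q" using lnq by (simp add: P_def) linarith
  have e: "exp 1 \<le> (3 :: real)" by (rule exp_le)
  \<comment> \<open>The long columns enter as an indicator sum over \<open>Q\<close>, the shape that
    \<open>expect_subset_sum_over\<close> evaluates.\<close>
  have split: "spec_norm n (restrict_cols A Q)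
      \<le> (\<Sum>j\<in>Q. if j \<in> L then col_norm n A j else 0) + spec_norm n (restrict_cols B Q)"
    if Q: "Q \<subseteq> {..<n}" for Q
  proof -
    have "restrict_cols A Q = (\<lambda>i j. restrict_cols A (Q \<inter> L) i j + restrict_cols B Q i j)"
      by (auto simp: restrict_cols_def B_def fun_eq_iff)
    then have "spec_norm n (restrict_cols A Q)
        \<le> spec_norm n (restrict_cols A (Q \<inter> L)) + spec_norm n (restrict_cols B Q)"
      using spec_norm_triangle by metis
    moreover have "spec_norm n (restrict_cols A (Q \<inter> L)) \<le> (\<Sum>j\<in>Q \<inter> L. col_norm n A j)"
      using Q by (intro spec_norm_restrict_le_col_norms) auto
    moreover have "(\<Sum>j\<in>Q \<inter> L. col_norm n A j) = (\<Sum>j\<in>Q. if j \<in> L then col_norm n A j else 0)"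
      using finite_subset[OF Q] by (simp add: sum.inter_restrict)
    ultimately show ?thesis by simp
  qed
  \<comment> \<open>Each long column is drawn with probability \<open>p\<close>, and
    \<open>p * k = 1\<close> cancels the factor in \<open>L_sum\<close>.\<close>
  have large: "expect_subset n p (\<lambda>Q. \<Sum>j\<in>Q. if j \<in> L then col_norm n A j else 0) \<le> \<kappa>"
  proof -
    have "expect_subset n p (\<lambda>Q. \<Sum>j\<in>Q. if j \<in> L then col_norm n A j else 0)
        = p * (\<Sum>j\<in>L. col_norm n A j)"
      using L by (simp add: expect_subset_sum_over expect_subset_const sum.If_cases Int_absorb1)
    also have "\<dots> \<le> p * (k * \<kappa>)" using p by (intro mult_left_mono L_sum)
    finally show ?thesis using p by (simp flip: mult.assoc)
  qed
  have "expect_subset n p (\<lambda>Q. spec_norm n (restrict_cols B Q))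
      \<le> 2 * sqrt (exp 1 * (exp 1 * p * (spec_norm n B)\<^sup>2 + P * (2 * \<kappa>)\<^sup>2))"
    unfolding p_def P_def
  proof (rule expect_spec_norm_restrict_le)
    show "col_norm n B j \<le> 2 * \<kappa>" if "j < n" for j
      using that \<kappa>
      by (cases "j \<in> L") (simp_all add: B_def restrict_cols_def col_norm_def L_def not_less)
  qed (use q \<kappa> in auto)
  \<comment> \<open>Both \<open>exp 1\<close> and the ratio of \<open>P\<close> to
    \<open>ln q\<close> are rounded up to 3. The coefficients become the squares 3 * 3 = 9 and 3 * 3
    * 4 = 36.\<close>
  also have "\<dots> \<le> 2 * sqrt (3 * (3 * p * (spec_norm n A)\<^sup>2 + (3 * ln q) * (2 * \<kappa>)\<^sup>2))"
    using e p P lnq \<kappa> spec_norm_restrict_le[of n A "- L"] spec_norm_nonneg[of n]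
    by (intro mult_left_mono real_sqrt_le_mono mult_mono add_mono power_mono) (auto simp: B_def P_def)
  also have "\<dots> = 2 * sqrt ((3 * sqrt p * spec_norm n A)\<^sup>2 + (6 * sqrt (ln q) * \<kappa>)\<^sup>2)"
    using p lnq by (simp add: power_mult_distrib algebra_simps)
  also have "\<dots> \<le> 2 * (3 * sqrt p * spec_norm n A + 6 * sqrt (ln q) * \<kappa>)"
    using p lnq \<kappa> spec_norm_nonneg[of n A] by (intro mult_left_mono sqrt_sum_squares_le_sum) auto
  finally have small: "expect_subset n p (\<lambda>Q. spec_norm n (restrict_cols B Q))
      \<le> 6 * (sqrt p * spec_norm n A) + 12 * (sqrt (ln q) * \<kappa>)"
    by simp
  have "1 / 2 \<le> sqrt (ln q)"
    using lnq by (intro real_le_rsqrt) (simp add: power2_eq_square)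
  then have "\<kappa> \<le> 2 * (sqrt (ln q) * \<kappa>)"
    using mult_right_mono[OF _ \<kappa>, of "1 / 2"] by fastforce
  moreover have "0 \<le> sqrt p * spec_norm n A"
    using p spec_norm_nonneg by simp
  moreover have "expect_subset n p (\<lambda>Q. spec_norm n (restrict_cols A Q))
      \<le> expect_subset n p (\<lambda>Q. \<Sum>j\<in>Q. if j \<in> L then col_norm n A j else 0)
        + expect_subset n p (\<lambda>Q. spec_norm n (restrict_cols B Q))"
    unfolding expect_subset_add[symmetric] using p split by (intro expect_subset_mono) auto
  ultimately show "expect_subset n (q / real n) (\<lambda>Q. spec_norm n (restrict_cols A Q))
      \<le> 14 * (sqrt (q / real n) * spec_norm n A + sqrt (ln q) * knorm n (real n / q) A)"
    using large small unfolding p_def[symmetric] k_def[symmetric] \<kappa>_def[symmetric] by simp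
qed simp

end
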